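(* Let $(\mathfrak g,J,g)$ be a four dimensional Kähler Lie algebra. Assume that there exists an abelian ideal $\mathfrak h\subset\mathfrak g$ such that the short exact sequence of Lie algebras (not necessarily split) $$0\longrightarrow \mathfrak h\longrightarrow \mathfrak g\longrightarrow \mathfrak k\longrightarrow 0$$ holds, where $\mathfrak h$ and $\mathfrak k$ are $J$-invariant totally isotropic subspaces. Then $\mathfrak g$ is isomorphic to one of the Lie algebras $\mathbb R\times\mathfrak h_3$, $\mathfrak{aff}(\mathbb C)$, $\mathfrak r_{4,-1,-1}$, $\mathfrak d_{4,1}$, $\mathfrak d_{4,2}$.
   Context: All Lie algebras are real and finite dimensional. A complex structure on $\mathfrak g$ is an endomorphism $J$ with $J^2=-I$ and $[Jx,Jy]-[x,y]-J[Jx,y]-J[x,Jy]=0$ for all $x,y$. A symplectic structure is a closed nondegenerate 2-form $\omega$ on $\mathfrak g$ (closed: $\omega([x,y],z)+\omega([y,z],x)+\omega([z,x],y)=0$). A Kähler Lie algebra is a Lie algebra with a complex structure $J$ and a symplectic structure $\omega$ with $\omega(Jx,Jy)=\omega(x,y)$; the associated pseudo-Kähler metric is $g(x,y)=\omega(Jx,y)$ (not necessarily definite), and one writes $(\mathfrak g,J,g)$. A subspace $W$ is totally isotropic if $W=W^{\perp}$, where $W^\perp=\{x: g(x,y)=0\ \forall y\in W\}$. In the exact sequence, $\mathfrak g=\mathfrak h\oplus\mathfrak k$ as vector spaces and the subspace $\mathfrak k$ is identified with the quotient $\mathfrak g/\mathfrak h$. The Lie algebras, in a basis $e_1,\dots,e_4$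 with the nonzero brackets: $\mathbb R\times\mathfrak h_3$: $[e_1,e_2]=e_3$. $\mathfrak{aff}(\mathbb C)$ (as a real Lie algebra): $[e_1,e_3]=e_3$, $[e_1,e_4]=e_4$, $[e_2,e_3]=e_4$, $[e_2,e_4]=-e_3$. $\mathfrak r_{4,-1,-1}$: $[e_4,e_1]=e_1$, $[e_4,e_2]=-e_2$, $[e_4,e_3]=-e_3$. $\mathfrak d_{4,\lambda}$: $[e_1,e_2]=e_3$, $[e_4,e_3]=e_3$, $[e_4,e_1]=\lambda e_1$, $[e_4,e_2]=(1-\lambda)e_2$.
   Formalization: The formal theorem additionally assumes that the Lie algebra is not abelian, since the abelian algebra ℝ⁴ with a neutral Kähler structure satisfies every hypothesis but is isomorphic to none of the five listed algebras. *)

theory Defs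
  imports "HOL-Analysis.Analysis"
begin

section \<open>Real Lie algebras\<close>

locale lie_algebra =
  fixes lie :: "'a::real_vector \<Rightarrow> 'a \<Rightarrow> 'a"
  assumes bilinear_lie: "bilinear lie"
    and lie_self: "lie x x = 0"
    and jacobi: "lie x (lie y z) + lie y (lie z x) + lie z (lie x y) = 0"

definition lie_isomorphic ::
  "('a::real_vector \<Rightarrow> 'a \<Rightarrow> 'a) \<Rightarrow> ('b::real_vector \<Rightarrow> 'b \<Rightarrow> 'b) \<Rightarrow> bool"
  where "lie_isomorphic lie1 lie2 \<longleftrightarrow>
    (\<exists>f. linear f \<and> bij f \<and> (\<forall>x y. f (lie1 x y) = lie2 (f x) (f y)))"

definition lie_ideal :: "('a::real_vector \<Rightarrow> 'a \<Rightarrow> 'a) \<Rightarrow> 'a set \<Rightarrow> bool"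
  where "lie_ideal lie h \<longleftrightarrow> subspace h \<and> (\<forall>x. \<forall>y\<in>h. lie x y \<in> h)"

definition lie_abelian_on :: "('a::real_vector \<Rightarrow> 'a \<Rightarrow> 'a) \<Rightarrow> 'a set \<Rightarrow> bool"
  where "lie_abelian_on lie h \<longleftrightarrow> (\<forall>x\<in>h. \<forall>y\<in>h. lie x y = 0)"

text \<open>
  The short exact sequence \<open>0 \<rightarrow> h \<rightarrow> g \<rightarrow> k \<rightarrow> 0\<close> of Lie algebras, in which \<open>k\<close> is a linear
  complement of \<open>h\<close> in \<open>g\<close>, identified with the quotient of \<open>g\<close> by \<open>h\<close>.  The map \<open>\<pi>\<close> is the
  quotient map read as a map onto \<open>k\<close>, so it is the identity on \<open>k\<close>; and \<open>lie_k\<close> is the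
  bracket of the quotient transported to \<open>k\<close>.  In general it is not the restriction of \<open>lie\<close>,
  because \<open>k\<close> need not be a subalgebra (the sequence need not split).
\<close>
definition lie_short_exact ::
  "('a::real_vector \<Rightarrow> 'a \<Rightarrow> 'a) \<Rightarrow> 'a set \<Rightarrow> 'a set \<Rightarrow> ('a \<Rightarrow> 'a \<Rightarrow> 'a) \<Rightarrow> ('a \<Rightarrow> 'a) \<Rightarrow> bool"
  where "lie_short_exact lie h k lie_k \<pi> \<longleftrightarrow>
    linear \<pi> \<and> range \<pi> = k \<and> {x. \<pi> x = 0} = h \<and> (\<forall>x\<in>k. \<pi> x = x) \<and>
    (\<forall>x y. \<pi> (lie x y) = lie_k (\<pi> x) (\<pi> y))"

text \<open>
  For an ideal \<open>h\<close>, the existence of such a sequence says no more than that \<open>k\<close> is a linear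
  complement of \<open>h\<close>.
\<close>
lemma ex_lie_short_exact_iff:
  assumes "lie_algebra lie" and "lie_ideal lie h"
  shows "(\<exists>lie_k \<pi>. lie_short_exact lie h k lie_k \<pi>) \<longleftrightarrow>
    subspace k \<and> h \<inter> k = {0} \<and> (\<forall>x. \<exists>u\<in>h. \<exists>v\<in>k. x = u + v)"
  (is "?L \<longleftrightarrow> ?R")
proof
  assume ?L
  then obtain lk p where p: "linear p" "range p = k" "{x. p x = 0} = h" "\<And>x. x \<in> k \<Longrightarrow> p x = x"
    unfolding lie_short_exact_def by blast
  have "subspace k"
    using linear_subspace_image[OF p(1) subspace_UNIV] p(2) by simp
  moreover have "h \<inter> k = {0}"
  proof (intro equalityI subsetI)
    fix x assume "x \<in> h \<inter> k"
    then show "x \<in> {0}" using p(3) p(4)[of x] by auto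
  next
    fix x assume "x \<in> {0 :: 'a}"
    then show "x \<in> h \<inter> k"
      using p(3) linear_0[OF p(1)] subspace_0[OF \<open>subspace k\<close>] by auto
  qed
  moreover have "\<exists>u\<in>h. \<exists>v\<in>k. x = u + v" for x
  proof (intro bexI)
    show "x = (x - p x) + p x" by simp
    show k: "p x \<in> k" using p(2) by blast
    have "p (x - p x) = 0"
      by (simp add: linear_diff[OF p(1)] p(4)[OF k])
    then show "x - p x \<in> h" using p(3) by blast
  qed
  ultimately show ?R by blast
next
  assume R: ?R
  have h: "subspace h" and hid: "\<And>x y. y \<in> h \<Longrightarrow> lie x y \<in> h"
    using assms(2) unfolding lie_ideal_def by auto
  interpret lie_algebra lie by fact
  have k: "subspace k" and hk: "h \<inter> k = {0}" using R by auto
  have "\<forall>x. \<exists>v. v \<in> k \<and> x - v \<in> h"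
  proof
    fix x
    obtain u v where "u \<in> h" "v \<in> k" "x = u + v" using R by blast
    then show "\<exists>v. v \<in> k \<and> x - v \<in> h" by (intro exI[of _ v]) simp
  qed
  then obtain p where p: "\<And>x. p x \<in> k" "\<And>x. x - p x \<in> h" by metis
  have uniq: "p x = v" if "v \<in> k" "x - v \<in> h" for x v
  proof -
    have "(x - v) - (x - p x) \<in> h" using subspace_diff[OF h that(2) p(2)] .
    moreover have "p x - v \<in> k" using subspace_diff[OF k p(1) that(1)] .
    ultimately have "p x - v \<in> h \<inter> k" by (simp add: algebra_simps)
    then show ?thesis using hk by simp
  qed
  have lin: "linear p"
  proof (rule linearI)
    fix x y :: 'a and c :: real
    have "(x - p x) + (y - p y) \<in> h" by (rule subspace_add[OF h p(2) p(2)])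
    then show "p (x + y) = p x + p y"
      by (intro uniq subspace_add[OF k p(1) p(1)]) (simp add: algebra_simps)
    have "c *\<^sub>R (x - p x) \<in> h" by (rule subspace_mul[OF h p(2)])
    then show "p (c *\<^sub>R x) = c *\<^sub>R p x"
      by (intro uniq subspace_mul[OF k p(1)]) (simp add: algebra_simps)
  qed
  have pid: "p x = x" if "x \<in> k" for x
    using that by (intro uniq) (simp_all add: subspace_0[OF h])
  have ran: "range p = k"
  proof
    show "range p \<subseteq> k" using p(1) by blast
    show "k \<subseteq> range p"
    proof
      fix x assume "x \<in> k"
      then have "x = p x" by (simp add: pid)
      then show "x \<in> range p" by (rule range_eqI)
    qed
  qed
  have p0: "p x = 0" if "x \<in> h" for x
    using that by (intro uniq) (simp_all add: subspace_0[OF k])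
  have ker: "{x. p x = 0} = h"
  proof (intro equalityI subsetI)
    fix x assume "x \<in> {x. p x = 0}"
    then show "x \<in> h" using p(2)[of x] by simp
  qed (simp add: p0)
  have skew: "lie x y = - lie y x" for x y
  proof -
    have "0 = lie (x + y) (x + y)" by (simp only: lie_self)
    also have "\<dots> = lie x (x + y) + lie y (x + y)" by (rule bilinear_ladd[OF bilinear_lie])
    also have "\<dots> = lie x y + lie y x" by (simp add: bilinear_radd[OF bilinear_lie] lie_self)
    finally have "lie x y + lie y x = 0" by simp
    then show ?thesis by (rule eq_neg_iff_add_eq_0[THEN iffD2])
  qed
  have "p (lie x y) = p (lie (p x) (p y))" for x y
  proof -
    have 1: "lie x (y - p y) \<in> h" by (rule hid[OF p(2)])
    have "lie (p y) (x - p x) \<in> h" by (rule hid[OF p(2)])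
    then have 2: "lie (x - p x) (p y) \<in> h"
      using skew[of "x - p x" "p y"] subspace_neg[OF h] by simp
    have "lie x y = lie x (y - p y) + lie (x - p x) (p y) + lie (p x) (p y)"
      by (simp add: bilinear_rsub[OF bilinear_lie] bilinear_lsub[OF bilinear_lie])
    then show ?thesis
      by (simp add: linear_add[OF lin] p0[OF 1] p0[OF 2])
  qed
  then have "lie_short_exact lie h k (\<lambda>x y. p (lie x y)) p"
    unfolding lie_short_exact_def using lin ran ker pid by blast
  then show ?L by blast
qed


section \<open>Kaehler Lie algebras\<close>

definition complex_structure ::
  "('a::real_vector \<Rightarrow> 'a \<Rightarrow> 'a) \<Rightarrow> ('a \<Rightarrow> 'a) \<Rightarrow> bool"
  where "complex_structure lie J \<longleftrightarrow>
    linear J \<and> (\<forall>x. J (J x) = - x) \<and>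
    (\<forall>x y. lie (J x) (J y) - lie x y - J (lie (J x) y) - J (lie x (J y)) = 0)"

definition symplectic_structure ::
  "('a::real_vector \<Rightarrow> 'a \<Rightarrow> 'a) \<Rightarrow> ('a \<Rightarrow> 'a \<Rightarrow> real) \<Rightarrow> bool"
  where "symplectic_structure lie \<omega> \<longleftrightarrow>
    bilinear \<omega> \<and> (\<forall>x. \<omega> x x = 0) \<and>
    (\<forall>x. (\<forall>y. \<omega> x y = 0) \<longrightarrow> x = 0) \<and>
    (\<forall>x y z. \<omega> (lie x y) z + \<omega> (lie y z) x + \<omega> (lie z x) y = 0)"

definition kaehler_lie_algebra ::
  "('a::real_vector \<Rightarrow> 'a \<Rightarrow> 'a) \<Rightarrow> ('a \<Rightarrow> 'a) \<Rightarrow> ('a \<Rightarrow> 'a \<Rightarrow> real) \<Rightarrow> bool"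
  where "kaehler_lie_algebra lie J \<omega> \<longleftrightarrow>
    lie_algebra lie \<and> complex_structure lie J \<and> symplectic_structure lie \<omega> \<and>
    (\<forall>x y. \<omega> (J x) (J y) = \<omega> x y)"

text \<open>Not necessarily definite.\<close>
definition kaehler_metric :: "('a \<Rightarrow> 'a) \<Rightarrow> ('a \<Rightarrow> 'a \<Rightarrow> real) \<Rightarrow> 'a \<Rightarrow> 'a \<Rightarrow> real"
  where "kaehler_metric J \<omega> x y = \<omega> (J x) y"

definition orthogonal_space :: "('a \<Rightarrow> 'a \<Rightarrow> real) \<Rightarrow> 'a set \<Rightarrow> 'a set"
  where "orthogonal_space g W = {x. \<forall>y\<in>W. g x y = 0}"

text \<open>Equality is required, not just inclusion of \<open>W\<close> in its orthogonal space.\<close>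
definition totally_isotropic :: "('a::real_vector \<Rightarrow> 'a \<Rightarrow> real) \<Rightarrow> 'a set \<Rightarrow> bool"
  where "totally_isotropic g W \<longleftrightarrow> subspace W \<and> W = orthogonal_space g W"


section \<open>The four-dimensional model Lie algebras\<close>

text \<open>
  The models live on \<open>real ^ 4\<close> with \<open>ebasis i\<close> the standard basis (in the index type \<open>4\<close> the
  numeral \<open>4\<close> equals \<open>0\<close>, and \<open>1, 2, 3, 4\<close> are its four distinct elements).  A relation
  \<open>[e\<^sub>i, e\<^sub>j] = v\<close> contributes the term \<open>wedge i j x y *\<^sub>R v\<close> to the bracket, where \<open>wedge i j\<close>
  is the exterior product of the coordinate forms dual to \<open>e\<^sub>i\<close> and \<open>e\<^sub>j\<close>.
\<close>

abbreviation ebasis :: "4 \<Rightarrow> real ^ 4"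
  where "ebasis i \<equiv> axis i 1"

definition wedge :: "4 \<Rightarrow> 4 \<Rightarrow> real ^ 4 \<Rightarrow> real ^ 4 \<Rightarrow> real"
  where "wedge i j x y = x $ i * y $ j - x $ j * y $ i"

definition lie_R_h3 :: "real ^ 4 \<Rightarrow> real ^ 4 \<Rightarrow> real ^ 4"
  where "lie_R_h3 x y = wedge 1 2 x y *\<^sub>R ebasis 3"

definition lie_aff_C :: "real ^ 4 \<Rightarrow> real ^ 4 \<Rightarrow> real ^ 4"
  where "lie_aff_C x y =
    wedge 1 3 x y *\<^sub>R ebasis 3 + wedge 1 4 x y *\<^sub>R ebasis 4 +
    wedge 2 3 x y *\<^sub>R ebasis 4 + wedge 2 4 x y *\<^sub>R (- ebasis 3)"

definition lie_r4_m1_m1 :: "real ^ 4 \<Rightarrow> real ^ 4 \<Rightarrow> real ^ 4"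
  where "lie_r4_m1_m1 x y =
    wedge 4 1 x y *\<^sub>R ebasis 1 + wedge 4 2 x y *\<^sub>R (- ebasis 2) + wedge 4 3 x y *\<^sub>R (- ebasis 3)"

definition lie_d4 :: "real \<Rightarrow> real ^ 4 \<Rightarrow> real ^ 4 \<Rightarrow> real ^ 4"
  where "lie_d4 t x y =
    wedge 1 2 x y *\<^sub>R ebasis 3 + wedge 4 3 x y *\<^sub>R ebasis 3 +
    wedge 4 1 x y *\<^sub>R (t *\<^sub>R ebasis 1) + wedge 4 2 x y *\<^sub>R ((1 - t) *\<^sub>R ebasis 2)"

text \<open>
  The abelian algebra \<open>real ^ 4\<close> also carries a Kaehler structure of neutral signature with two
  complementary \<open>J\<close>-invariant totally isotropic planes, and it is isomorphic to none of the models
  above.  The classification therefore concerns non-abelian Lie algebras.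
\<close>

end

theory Submission
  imports Defs
begin

text \<open>
  The ideal \<open>h\<close> and the complement \<open>k\<close> are \<open>J\<close>-invariant, so isotropy for the metric makes both of
  them Lagrangian for \<open>\<omega>\<close>, and \<open>\<omega>\<close> pairs them nondegenerately; each is a complex line.
  Choose \<open>v \<in> k\<close> nonzero and let \<open>u \<in> h\<close> be dual to it, \<open>\<omega> u v = 1\<close> and \<open>\<omega> (J u) v = 0\<close>.  Identify
  \<open>h\<close> with the complex numbers by \<open>\<iota> z = Re z u + Im z J u\<close>; then \<open>J\<close> is multiplication by \<open>\<i>\<close> and
  pairing with \<open>v\<close> is the real part.  Replacing \<open>v\<close> by a complex multiple brings the bracket of
  the quotient to \<open>[v, J v] = \<tau> J v + \<iota> w\<close> with \<open>\<tau> \<in> {0, 1}\<close>.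

  Every real-linear map of the complex plane has the form \<open>z \<mapsto> a z + p \<zeta>\<close> with \<open>\<zeta>\<close> the conjugate
  of \<open>z\<close>.  Write the action of \<open>v\<close> on \<open>h\<close> in this way, with coefficients \<open>a, p\<close>.  Integrability of
  \<open>J\<close> says that \<open>J v\<close> acts by \<open>z \<mapsto> b z + \<i> p \<zeta>\<close>, with the same \<open>p\<close>, and closedness of \<open>\<omega>\<close>
  determines \<open>b\<close> from \<open>a\<close>, \<open>p\<close> and \<open>\<tau>\<close> (lemma \<open>normal_form\<close>).  What is left of the Jacobi identity
  is the pair of equations \<open>\<tau> b = - 2 \<i> |p|^2\<close> and \<open>p (\<i> (a - cnj a) + cnj b - b) = \<i> \<tau> p\<close>
  (lemma \<open>jacobi_coefficients\<close>).

  If \<open>\<tau> = 0\<close>, then \<open>p = 0\<close> and \<open>b = - \<i> a\<close>, so \<open>k\<close> acts on \<open>h\<close> by complex multiplications: either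
  trivially, which gives \<open>\<real> \<times> h\<^sub>3\<close> because \<open>w \<noteq> 0\<close> in a nonabelian algebra,
  or by all of them, which gives \<open>aff(\<complex>)\<close>.
  If \<open>\<tau> = 1\<close>, the equations have exactly three solutions, \<open>p = 0\<close>, \<open>p = 1/2\<close> and \<open>p = - 1/2\<close>, with
  \<open>a\<close> and \<open>b\<close> determined by \<open>p\<close>, and they give \<open>r\<^sub>4\<^sub>,\<^sub>-\<^sub>1\<^sub>,\<^sub>-\<^sub>1\<close>, \<open>d\<^sub>4\<^sub>,\<^sub>1\<close> and \<open>d\<^sub>4\<^sub>,\<^sub>2\<close> respectively.  In every
  case except \<open>\<real> \<times> h\<^sub>3\<close> the term \<open>\<iota> w\<close>, the failure of \<open>k\<close> to be a subalgebra, is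
  absorbed by moving the generators of \<open>k\<close> by elements of \<open>h\<close>.
\<close>

section \<open>Recognizing a Lie algebra from the brackets of a basis\<close>

definition comb :: "'a::real_vector \<Rightarrow> 'a \<Rightarrow> 'a \<Rightarrow> 'a \<Rightarrow> real ^ 4 \<Rightarrow> 'a"
  where "comb e1 e2 e3 e4 x = x $ 1 *\<^sub>R e1 + x $ 2 *\<^sub>R e2 + x $ 3 *\<^sub>R e3 + x $ 4 *\<^sub>R e4"

definition no_relation :: "'a::real_vector \<Rightarrow> 'a \<Rightarrow> 'a \<Rightarrow> 'a \<Rightarrow> bool"
  where "no_relation e1 e2 e3 e4 \<longleftrightarrow>
    (\<forall>c1 c2 c3 c4. c1 *\<^sub>R e1 + c2 *\<^sub>R e2 + c3 *\<^sub>R e3 + c4 *\<^sub>R e4 = 0 \<longrightarrow>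
      c1 = 0 \<and> c2 = 0 \<and> c3 = 0 \<and> c4 = 0)"

lemma linear_comb: "linear (comb e1 e2 e3 e4)"
  by (rule linearI) (simp_all add: comb_def algebra_simps)

lemma comb_ebasis:
  "comb e1 e2 e3 e4 (ebasis 1) = e1" "comb e1 e2 e3 e4 (ebasis 2) = e2"
  "comb e1 e2 e3 e4 (ebasis 3) = e3" "comb e1 e2 e3 e4 (ebasis 4) = e4"
  by (simp_all add: comb_def axis_def)

text \<open>
  An infinite-dimensional space has \<open>dim\<close> equal to \<open>0\<close>.  Dimension \<open>4\<close> therefore provides a finite
  spanning set of four vectors, and no independent set can have a fifth element.
\<close>
lemma bij_comb:
  fixes e1 e2 e3 e4 :: "'a::real_vector"
  assumes dim: "dim (UNIV :: 'a set) = 4" and rel: "no_relation e1 e2 e3 e4"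
  shows "bij (comb e1 e2 e3 e4)"
proof -
  let ?f = "comb e1 e2 e3 e4"
  have inj: "inj ?f"
    unfolding linear_injective_0[OF linear_comb]
  proof (intro allI impI)
    fix x assume "?f x = 0"
    then have "x $ 1 = 0 \<and> x $ 2 = 0 \<and> x $ 3 = 0 \<and> x $ 4 = 0"
      using rel unfolding comb_def no_relation_def by blast
    then show "x = 0" by (simp add: vec_eq_iff forall_4)
  qed
  let ?S = "?f ` Basis"
  have ind: "independent ?S"
    by (rule linear_independent_injective_image[OF linear_comb independent_Basis inj_on_subset[OF inj subset_UNIV]])
  have card: "card ?S = 4"
  proof -
    have "card ?S = card (Basis :: (real ^ 4) set)"
      by (rule card_image[OF inj_on_subset[OF inj subset_UNIV]])
    then show ?thesis by simp
  qed
  obtain B :: "'a set" where B: "UNIV \<subseteq> span B" "card B = 4"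
    by (rule basis_exists[of "UNIV :: 'a set"]) (simp add: dim that)
  have "finite B" by (rule card_ge_0_finite) (simp add: B(2))
  have "x \<in> span ?S" for x
  proof (rule ccontr)
    assume x: "x \<notin> span ?S"
    then have "x \<notin> ?S" by (rule contrapos_nn) (rule span_base)
    moreover have "finite ?S" by (rule card_ge_0_finite) (simp only: card)
    ultimately have "card (insert x ?S) = 5" using card by simp
    moreover have "independent (insert x ?S)" using x ind by (rule independent_insertI)
    moreover have "insert x ?S \<subseteq> span B" using B(1) subset_UNIV by (rule order_trans[rotated])
    ultimately have "5 \<le> card B" using independent_span_bound[OF \<open>finite B\<close>] by metis
    then show False using B(2) by simp
  qed
  then have "span ?S = UNIV" by blast
  moreover have "span ?S = range ?f"
    by (simp add: linear_span_image[OF linear_comb])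
  ultimately show ?thesis using inj by (simp add: bij_def)
qed

context lie_algebra
begin

lemmas lie_simps =
  bilinear_ladd[OF bilinear_lie] bilinear_radd[OF bilinear_lie]
  bilinear_lmul[OF bilinear_lie] bilinear_rmul[OF bilinear_lie]
  bilinear_lneg[OF bilinear_lie] bilinear_rneg[OF bilinear_lie]
  bilinear_lsub[OF bilinear_lie] bilinear_rsub[OF bilinear_lie]
  bilinear_lzero[OF bilinear_lie] bilinear_rzero[OF bilinear_lie] lie_self

lemma lie_skew: "lie x y = - lie y x"
proof -
  have "lie x (x + y) + lie y (x + y) = 0"
    using lie_self[of "x + y"] unfolding bilinear_ladd[OF bilinear_lie] .
  then have "lie x y + lie y x = 0" by (simp add: lie_simps)
  then show ?thesis by (rule eq_neg_iff_add_eq_0[THEN iffD2])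
qed

lemma lie_comb:
  "lie (comb e1 e2 e3 e4 x) (comb e1 e2 e3 e4 y) =
    wedge 1 2 x y *\<^sub>R lie e1 e2 + wedge 1 3 x y *\<^sub>R lie e1 e3 + wedge 1 4 x y *\<^sub>R lie e1 e4 +
    wedge 2 3 x y *\<^sub>R lie e2 e3 + wedge 2 4 x y *\<^sub>R lie e2 e4 + wedge 3 4 x y *\<^sub>R lie e3 e4"
  unfolding comb_def wedge_def
  by (simp add: lie_simps lie_skew[of e2 e1] lie_skew[of e3 e1] lie_skew[of e4 e1]
      lie_skew[of e3 e2] lie_skew[of e4 e2] lie_skew[of e4 e3] algebra_simps)

text \<open>
  The inverse of the coordinate map of a basis is the isomorphism, so it suffices that the
  coordinate map itself is compatible with the brackets.  The criteria for the individual models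
  follow by comparing the six brackets of basis vectors in \<open>lie_comb\<close>.
\<close>
lemma lie_isomorphicI:
  assumes dim: "dim (UNIV :: 'a set) = 4" and rel: "no_relation e1 e2 e3 e4"
    and hom: "\<And>x y. comb e1 e2 e3 e4 (m x y) = lie (comb e1 e2 e3 e4 x) (comb e1 e2 e3 e4 y)"
  shows "lie_isomorphic lie m"
proof -
  let ?f = "comb e1 e2 e3 e4"
  have bij: "bij ?f" by (rule bij_comb[OF dim rel])
  have f_inv: "?f (inv ?f x) = x" and inv_f: "inv ?f (?f y) = y" for x y
    using bij by (simp_all add: bij_is_surj bij_is_inj surj_f_inv_f inv_f_f)
  have "inv ?f (lie x y) = m (inv ?f x) (inv ?f y)" for x y
  proof -
    have "inv ?f (lie x y) = inv ?f (?f (m (inv ?f x) (inv ?f y)))" by (simp only: hom f_inv)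
    then show ?thesis by (simp only: inv_f)
  qed
  moreover have "linear (inv ?f)"
  proof (rule linearI)
    fix x y :: 'a and c :: real
    have "inv ?f (x + y) = inv ?f (?f (inv ?f x + inv ?f y))"
      by (simp only: linear_add[OF linear_comb] f_inv)
    then show "inv ?f (x + y) = inv ?f x + inv ?f y" by (simp only: inv_f)
    have "inv ?f (c *\<^sub>R x) = inv ?f (?f (c *\<^sub>R inv ?f x))"
      by (simp only: linear_scale[OF linear_comb] f_inv)
    then show "inv ?f (c *\<^sub>R x) = c *\<^sub>R inv ?f x" by (simp only: inv_f)
  qed
  ultimately show ?thesis
    unfolding lie_isomorphic_def using bij_imp_bij_inv[OF bij] by blast
qed

lemma wedge_skew: "wedge 4 i x y = - wedge i 4 x y"
  by (simp add: wedge_def)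

lemmas comb_simps = linear_add[OF linear_comb] linear_scale[OF linear_comb]
  linear_neg[OF linear_comb] linear_diff[OF linear_comb] comb_ebasis

lemma isomorphic_R_h3I:
  assumes "dim (UNIV :: 'a set) = 4" "no_relation e1 e2 e3 e4"
    "lie e1 e2 = e3" "lie e1 e3 = 0" "lie e1 e4 = 0" "lie e2 e3 = 0" "lie e2 e4 = 0" "lie e3 e4 = 0"
  shows "lie_isomorphic lie lie_R_h3"
  by (rule lie_isomorphicI[OF assms(1,2)])
    (simp add: lie_R_h3_def lie_comb assms(3-) comb_simps)

lemma isomorphic_aff_CI:
  assumes "dim (UNIV :: 'a set) = 4" "no_relation e1 e2 e3 e4"
    "lie e1 e2 = 0" "lie e1 e3 = e3" "lie e1 e4 = e4" "lie e2 e3 = e4" "lie e2 e4 = - e3" "lie e3 e4 = 0"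
  shows "lie_isomorphic lie lie_aff_C"
  by (rule lie_isomorphicI[OF assms(1,2)])
    (simp add: lie_aff_C_def lie_comb assms(3-) comb_simps)

lemma isomorphic_r4_m1_m1I:
  assumes "dim (UNIV :: 'a set) = 4" "no_relation e1 e2 e3 e4"
    "lie e1 e2 = 0" "lie e1 e3 = 0" "lie e1 e4 = - e1" "lie e2 e3 = 0" "lie e2 e4 = e2" "lie e3 e4 = e3"
  shows "lie_isomorphic lie lie_r4_m1_m1"
  by (rule lie_isomorphicI[OF assms(1,2)])
    (simp add: lie_r4_m1_m1_def lie_comb assms(3-) comb_simps wedge_skew)

lemma isomorphic_d4I:
  assumes "dim (UNIV :: 'a set) = 4" "no_relation e1 e2 e3 e4"
    "lie e1 e2 = e3" "lie e1 e3 = 0" "lie e1 e4 = - t *\<^sub>R e1" "lie e2 e3 = 0"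
    "lie e2 e4 = - (1 - t) *\<^sub>R e2" "lie e3 e4 = - e3"
  shows "lie_isomorphic lie (lie_d4 t)"
  by (rule lie_isomorphicI[OF assms(1,2)])
    (simp add: lie_d4_def lie_comb assms(3-) comb_simps wedge_skew algebra_simps)

end

section \<open>Real-linear maps of the complex plane\<close>

lemma real_linear_complex:
  assumes "linear (f :: complex \<Rightarrow> complex)"
  shows "\<exists>a p. \<forall>z. f z = a * z + p * cnj z"
proof (intro exI allI)
  fix z
  have "z = Re z *\<^sub>R 1 + Im z *\<^sub>R \<i>" by (simp add: complex_eq_iff)
  then have "f z = f (Re z *\<^sub>R 1 + Im z *\<^sub>R \<i>)" by (rule arg_cong)
  also have "\<dots> = Re z *\<^sub>R f 1 + Im z *\<^sub>R f \<i>"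
    by (simp only: linear_add[OF assms] linear_scale[OF assms])
  also have "\<dots> = (f 1 - \<i> * f \<i>) / 2 * z + (f 1 + \<i> * f \<i>) / 2 * cnj z"
    by (simp add: complex_eq_iff field_simps)
  finally show "f z = (f 1 - \<i> * f \<i>) / 2 * z + (f 1 + \<i> * f \<i>) / 2 * cnj z" .
qed

lemma conjugate_polynomial_unique:
  assumes "\<And>z :: complex. a * z + p * cnj z = b * z + q * cnj z"
  shows "a = b \<and> p = q"
  using assms[of 1] assms[of \<i>]
  by (simp add: complex_eq_iff)

lemma conjugate_polynomial_zero_Re:
  assumes "\<And>z :: complex. Re (a * z + p * cnj z) = 0"
  shows "a = - cnj p"
  using assms[of 1] assms[of \<i>]
  by (simp add: complex_eq_iff)


section \<open>The normal form and its classification\<close>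

text \<open>
  The complex structure and the symplectic form have disappeared here: integrability is the
  occurrence of the same \<open>p\<close> in both actions on the image of \<open>\<iota>\<close>, and closedness is the equation
  for \<open>b\<close>.  The vector \<open>v'\<close> plays the role of \<open>J v\<close>.
\<close>
locale kaehler_normal_form = lie_algebra lie
  for lie :: "'a::real_vector \<Rightarrow> 'a \<Rightarrow> 'a" +
  fixes v v' :: 'a and \<iota> :: "complex \<Rightarrow> 'a" and a b p w :: complex and \<tau> :: real
  assumes dim_4: "dim (UNIV :: 'a set) = 4"
    and linear_iota: "linear \<iota>"
    and free: "s *\<^sub>R v + t *\<^sub>R v' + \<iota> z = 0 \<Longrightarrow> s = 0 \<and> t = 0 \<and> z = 0"
    and lie_iota: "lie (\<iota> z) (\<iota> z') = 0"
    and lie_v: "lie v (\<iota> z) = \<iota> (a * z + p * cnj z)"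
    and lie_v': "lie v' (\<iota> z) = \<iota> (b * z + \<i> * p * cnj z)"
    and lie_v_v': "lie v v' = \<tau> *\<^sub>R v' + \<iota> w"
    and omega_compatible: "b = - \<i> * a - \<i> * of_real \<tau> + 2 * \<i> * cnj p"
begin

text \<open>
  Coordinates in which all further computations take place, in two real numbers and a complex
  number.
\<close>
definition elem :: "real \<Rightarrow> real \<Rightarrow> complex \<Rightarrow> 'a"
  where "elem s t z = s *\<^sub>R v + t *\<^sub>R v' + \<iota> z"

lemmas iota_simps = linear_add[OF linear_iota] linear_scale[OF linear_iota]
  linear_diff[OF linear_iota] linear_neg[OF linear_iota] linear_0[OF linear_iota]

lemma elem_zero: "elem 0 0 0 = 0"
  by (simp add: elem_def iota_simps)

lemma elem_add: "elem s t z + elem s' t' z' = elem (s + s') (t + t') (z + z')"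
  by (simp add: elem_def iota_simps algebra_simps)

lemma elem_scale: "c *\<^sub>R elem s t z = elem (c * s) (c * t) (c *\<^sub>R z)"
  by (simp add: elem_def iota_simps algebra_simps)

lemma elem_uminus: "- elem s t z = elem (- s) (- t) (- z)"
  by (simp add: elem_def iota_simps algebra_simps)

lemma elem_eqI: "s = s' \<Longrightarrow> t = t' \<Longrightarrow> Re z = Re z' \<Longrightarrow> Im z = Im z' \<Longrightarrow> elem s t z = elem s' t' z'"
  using complex_eqI[of z z'] by simp

lemma lie_elem:
  "lie (elem s t z) (elem s' t' z') =
    elem 0 (\<tau> * (s * t' - t * s'))
      (s *\<^sub>R (a * z' + p * cnj z') + t *\<^sub>R (b * z' + \<i> * p * cnj z')
       - s' *\<^sub>R (a * z + p * cnj z) - t' *\<^sub>R (b * z + \<i> * p * cnj z) + (s * t' - t * s') *\<^sub>R w)"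
proof -
  have "lie (\<iota> z) v = - \<iota> (a * z + p * cnj z)" "lie (\<iota> z) v' = - \<iota> (b * z + \<i> * p * cnj z)"
    "lie v' v = - (\<tau> *\<^sub>R v' + \<iota> w)"
    by (subst lie_skew, simp only: lie_v lie_v' lie_v_v')+
  then show ?thesis
    unfolding elem_def
    by (simp only: lie_simps lie_v lie_v' lie_v_v' lie_iota) (simp add: iota_simps algebra_simps)
qed

lemma no_relation_elem:
  assumes "\<And>c1 c2 c3 c4.
      c1 * s1 + c2 * s2 + c3 * s3 + c4 * s4 = 0 \<Longrightarrow> c1 * t1 + c2 * t2 + c3 * t3 + c4 * t4 = 0 \<Longrightarrow>
      c1 *\<^sub>R z1 + c2 *\<^sub>R z2 + c3 *\<^sub>R z3 + c4 *\<^sub>R z4 = 0 \<Longrightarrow>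
      c1 = 0 \<and> c2 = 0 \<and> c3 = 0 \<and> c4 = 0"
  shows "no_relation (elem s1 t1 z1) (elem s2 t2 z2) (elem s3 t3 z3) (elem s4 t4 z4)"
  unfolding no_relation_def elem_scale elem_add
  using assms free unfolding elem_def by blast

lemma elem_surj: "\<exists>s t z. x = elem s t z"
proof -
  have "no_relation (elem 1 0 0) (elem 0 1 0) (elem 0 0 1) (elem 0 0 \<i>)"
    by (rule no_relation_elem) (simp add: complex_eq_iff)
  then have "bij (comb (elem 1 0 0) (elem 0 1 0) (elem 0 0 1) (elem 0 0 \<i>))"
    by (rule bij_comb[OF dim_4])
  then obtain y where "x = comb (elem 1 0 0) (elem 0 1 0) (elem 0 0 1) (elem 0 0 \<i>) y"
    by (metis bij_pointE)
  then show ?thesis unfolding comb_def elem_scale elem_add by blast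
qed

text \<open>
  The Jacobi identity for \<open>v\<close>, \<open>v'\<close> and \<open>\<iota> z\<close> says that the commutator of the actions of \<open>v\<close> and
  \<open>v'\<close> is the action of \<open>\<tau> v'\<close>, because \<open>\<iota> w\<close> acts trivially.  The two equations are its
  complex-linear and its conjugate-linear part.
\<close>
lemma jacobi_coefficients:
  "\<tau> * b = - 2 * \<i> * p * cnj p"
  "p * (\<i> * (a - cnj a) + cnj b - b) = \<i> * \<tau> * p"
proof -
  have inj: "z = z'" if "\<iota> z = \<iota> z'" for z z'
    using free[of 0 0 "z - z'"] that by (simp add: iota_simps)
  have comm: "a * (b * z + \<i> * p * cnj z) + p * cnj (b * z + \<i> * p * cnj z) =
      b * (a * z + p * cnj z) + \<i> * p * cnj (a * z + p * cnj z) + \<tau> *\<^sub>R (b * z + \<i> * p * cnj z)" for z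
  proof (rule inj)
    have sk: "lie (\<iota> z) v = - lie v (\<iota> z)" "lie (\<iota> z) v' = - lie v' (\<iota> z)" for z
      by (rule lie_skew)+
    show "\<iota> (a * (b * z + \<i> * p * cnj z) + p * cnj (b * z + \<i> * p * cnj z)) =
      \<iota> (b * (a * z + p * cnj z) + \<i> * p * cnj (a * z + p * cnj z) + \<tau> *\<^sub>R (b * z + \<i> * p * cnj z))"
      using jacobi[of v v' "\<iota> z"]
      unfolding lie_v_v' lie_v' sk lie_v lie_simps lie_iota
      by (simp only: linear_add[OF linear_iota] linear_scale[OF linear_iota]) (simp add: algebra_simps)
  qed
  have "(a * b - \<i> * p * cnj p) * z + (\<i> * a * p + p * cnj b) * cnj z =
      (b * a + \<i> * p * cnj p + \<tau> * b) * z + (b * p + \<i> * p * cnj a + \<tau> * \<i> * p) * cnj z" for z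
    using comm[of z] by (simp add: algebra_simps scaleR_conv_of_real)
  then have "a * b - \<i> * p * cnj p = b * a + \<i> * p * cnj p + \<tau> * b \<and>
      \<i> * a * p + p * cnj b = b * p + \<i> * p * cnj a + \<tau> * \<i> * p"
    by (rule conjugate_polynomial_unique)
  then show "\<tau> * b = - 2 * \<i> * p * cnj p" "p * (\<i> * (a - cnj a) + cnj b - b) = \<i> * \<tau> * p"
    by (simp_all add: algebra_simps eq_neg_iff_add_eq_0)
qed

text \<open>
  Here \<open>p = 0\<close> and \<open>b = - \<i> a\<close>, hence \<open>s v + t v'\<close> acts as multiplication by \<open>(s - \<i> t) a\<close>.  For
  \<open>a = 0\<close> the only nonzero bracket is \<open>[v, v'] = \<iota> w\<close>.  For \<open>a \<noteq> 0\<close> some combinations of \<open>v\<close> and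
  \<open>v'\<close> act as \<open>1\<close> and as \<open>\<i>\<close>.
\<close>
lemma classification_abelian_quotient:
  assumes "\<tau> = 0" and "\<not> lie_abelian_on lie UNIV"
  shows "lie_isomorphic lie lie_R_h3 \<or> lie_isomorphic lie lie_aff_C"
proof -
  have p: "p = 0" using jacobi_coefficients(1) assms(1) by simp
  have b: "b = - \<i> * a" using omega_compatible assms(1) p by simp
  note br = lie_elem[unfolded p b assms(1)]
  show ?thesis
  proof (cases "a = 0")
    case True
    have "w \<noteq> 0"
    proof
      assume "w = 0"
      then have "lie (elem s t z) (elem s' t' z') = 0" for s t z s' t' z'
        by (simp add: br True elem_zero)
      then have "lie_abelian_on lie UNIV"
        unfolding lie_abelian_on_def using elem_surj by metis
      then show False using assms(2) by simp
    qed
    have "lie_isomorphic lie lie_R_h3"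
    proof (rule isomorphic_R_h3I[OF dim_4])
      show "no_relation (elem 1 0 0) (elem 0 1 0) (elem 0 0 w) (elem 0 0 (\<i> * w))"
      proof (rule no_relation_elem, goal_cases)
        case (1 c1 c2 c3 c4)
        then have "(of_real c3 + \<i> * of_real c4) * w = 0"
          by (simp add: scaleR_conv_of_real algebra_simps)
        then have "of_real c3 + \<i> * of_real c4 = 0" using \<open>w \<noteq> 0\<close> by simp
        then show ?case using 1 by (simp add: complex_eq_iff)
      qed
    qed (simp_all add: br True elem_zero)
    then show ?thesis ..
  next
    case False
    define q where "q = inverse a"
    define r where "r = (Re q)\<^sup>2 + (Im q)\<^sup>2"
    have qa: "of_real (Re q) * a + \<i> * of_real (Im q) * a = 1"
    proof -
      have "(of_real (Re q) + \<i> * of_real (Im q)) * a = 1"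
        using False unfolding complex_eq[symmetric] q_def by simp
      then show ?thesis by (simp only: distrib_right)
    qed
    have r0: "r \<noteq> 0"
      using False by (simp add: r_def q_def complex_eq_iff sum_power2_eq_zero_iff)
    have "lie_isomorphic lie lie_aff_C"
    proof (rule isomorphic_aff_CI[OF dim_4])
      \<comment> \<open>With \<open>q = 1/a\<close>, the factor \<open>(s - \<i> t) a\<close> is \<open>1\<close> for \<open>s - \<i> t = q\<close> and \<open>\<i>\<close> for \<open>s - \<i> t = \<i> q\<close>.
          The bracket of these two vectors is \<open>- |q|^2 \<iota> w\<close>; since \<open>?e1\<close> acts as the identity,
          adding \<open>|q|^2 \<iota> w\<close> to the second one makes them commute.\<close>
      let ?e1 = "elem (Re q) (- Im q) 0"
      let ?e2 = "elem (- Im q) (- Re q) (r *\<^sub>R w)"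
      have act1: "lie ?e1 (elem 0 0 z) = elem 0 0 z" for z
      proof -
        have "lie ?e1 (elem 0 0 z) = elem 0 0 ((of_real (Re q) * a + \<i> * of_real (Im q) * a) * z)"
          by (simp add: br scaleR_conv_of_real algebra_simps)
        then show ?thesis by (simp add: qa)
      qed
      have act2: "lie ?e2 (elem 0 0 z) = elem 0 0 (\<i> * z)" for z
      proof -
        have "lie ?e2 (elem 0 0 z) = elem 0 0 (\<i> * ((of_real (Re q) * a + \<i> * of_real (Im q) * a) * z))"
          by (simp add: br scaleR_conv_of_real algebra_simps)
        then show ?thesis by (simp add: qa)
      qed
      show "no_relation ?e1 ?e2 (elem 0 0 1) (elem 0 0 \<i>)"
      proof (rule no_relation_elem, goal_cases)
        case (1 c1 c2 c3 c4)
        then have e: "c1 * Re q = c2 * Im q" "c1 * Im q = - c2 * Re q" by simp_all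
        have "c1 * r = (c1 * Re q) * Re q + (c1 * Im q) * Im q"
          by (simp add: r_def power2_eq_square algebra_simps)
        also have "\<dots> = 0" unfolding e by simp
        finally have c1: "c1 = 0" using r0 by simp
        then have "c2 = 0" using e r0 by (auto simp: r_def)
        then show ?case using 1 c1 by (simp add: complex_eq_iff)
      qed
      have "lie ?e1 ?e2 = lie ?e1 (elem 0 0 (r *\<^sub>R w))
          + lie ?e1 (elem (- Im q) (- Re q) 0)"
        by (simp add: elem_add flip: bilinear_radd[OF bilinear_lie])
      also have "lie ?e1 (elem (- Im q) (- Re q) 0) = elem 0 0 (- r *\<^sub>R w)"
        unfolding br by (intro elem_eqI) (simp_all add: r_def power2_eq_square algebra_simps)
      finally show "lie ?e1 ?e2 = 0" by (simp add: act1 elem_add elem_zero)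
      show "lie ?e1 (elem 0 0 1) = elem 0 0 1" "lie ?e1 (elem 0 0 \<i>) = elem 0 0 \<i>"
        by (rule act1)+
      show "lie ?e2 (elem 0 0 1) = elem 0 0 \<i>" "lie ?e2 (elem 0 0 \<i>) = - elem 0 0 1"
        by (simp_all add: act2 elem_uminus)
      show "lie (elem 0 0 1) (elem 0 0 \<i>) = 0"
        by (simp add: br elem_zero)
    qed
    then show ?thesis ..
  qed
qed

text \<open>
  The linear part of the Jacobi identity gives \<open>b = - 2 \<i> |p|^2\<close>, and the equation for \<open>b\<close> then
  gives \<open>a\<close> as a function of \<open>p\<close>.  If \<open>p \<noteq> 0\<close>, it can be cancelled in the conjugate-linear part;
  the imaginary part of \<open>a\<close>, which is \<open>- 2 Im p\<close>, and \<open>1 - 4 |p|^2\<close> must then vanish.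
\<close>
lemma coefficients_nonabelian_quotient:
  assumes "\<tau> = 1"
  shows "p = 0 \<and> a = - 1 \<and> b = 0 \<or> p = 1/2 \<and> a = 1/2 \<and> b = - \<i>/2 \<or> p = - 1/2 \<and> a = - 3/2 \<and> b = - \<i>/2"
proof -
  have b: "b = - 2 * \<i> * p * cnj p" using jacobi_coefficients(1) assms by simp
  then have "- \<i> * a - \<i> + 2 * \<i> * cnj p = - 2 * \<i> * p * cnj p" using omega_compatible assms by simp
  then have a: "a = 2 * p * cnj p - 1 + 2 * cnj p" by (simp add: complex_eq_iff)
  show ?thesis
  proof (cases "p = 0")
    case True
    then show ?thesis using a b by simp
  next
    case False
    then have "\<i> * (a - cnj a) + cnj b - b = \<i>" using jacobi_coefficients(2) assms by simp
    then have q: "Im p = 0" "4 * (Re p * Re p) + 4 * (Im p * Im p) = 1"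
      unfolding a b by (auto simp: complex_eq_iff)
    have "4 * (Re p * Re p) = 1" using q(2) unfolding q(1) by simp
    then have "(Re p)\<^sup>2 = (1/2)\<^sup>2" by (simp add: power2_eq_square)
    with q(1) have "p = 1/2 \<or> p = - 1/2"
      by (auto simp: power2_eq_iff complex_eq_iff)
    then show ?thesis
    proof
      assume p: "p = 1/2"
      show ?thesis unfolding a b p by simp
    next
      assume p: "p = - 1/2"
      show ?thesis unfolding a b p by simp
    qed
  qed
qed

lemma classification_nonabelian_quotient:
  assumes \<tau>: "\<tau> = 1"
  shows "lie_isomorphic lie lie_r4_m1_m1 \<or> lie_isomorphic lie (lie_d4 1) \<or> lie_isomorphic lie (lie_d4 2)"
  using coefficients_nonabelian_quotient[OF \<tau>]
proof (elim disjE conjE)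
  assume c: "p = 0" "a = - 1" "b = 0"
  \<comment> \<open>Now \<open>v\<close> acts as \<open>- 1\<close> and \<open>v'\<close> as \<open>0\<close>.  The vector \<open>v' + \<iota> z\<close> satisfies
      \<open>[v, v' + \<iota> z] = v' + \<iota> z\<close> exactly when \<open>2 z = w\<close>.\<close>
  have "lie_isomorphic lie lie_r4_m1_m1"
  proof (rule isomorphic_r4_m1_m1I[OF dim_4])
    show "no_relation (elem 0 1 (w / 2)) (elem 0 0 1) (elem 0 0 \<i>) (elem 1 0 0)"
      by (rule no_relation_elem) (simp add: complex_eq_iff)
  qed (unfold lie_elem c \<tau> elem_scale elem_uminus elem_zero[symmetric]; intro elem_eqI; simp)+
  then show ?thesis by blast
next
  assume c: "p = 1/2" "a = 1/2" "b = - \<i>/2"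
  \<comment> \<open>Now \<open>v\<close> acts as the projection to the real axis, and \<open>v'\<close> sends \<open>\<i>\<close> to \<open>1\<close> and \<open>1\<close> to \<open>0\<close>.  Adding
      some \<open>\<iota> z\<close> to \<open>v'\<close> removes only the imaginary part of \<open>w\<close>; the real part is removed by
      adding a multiple of \<open>\<iota> \<i>\<close> to \<open>v\<close>, which changes \<open>[v, v']\<close> by a multiple of \<open>\<iota> 1\<close>.\<close>
  have "lie_isomorphic lie (lie_d4 1)"
  proof (rule isomorphic_d4I[OF dim_4])
    show "no_relation (elem 0 1 (\<i> * Im w)) (elem 0 0 \<i>) (elem 0 0 1) (elem 1 0 (\<i> * Re w))"
      by (rule no_relation_elem) (simp add: complex_eq_iff)
  qed (unfold lie_elem c \<tau> elem_scale elem_uminus elem_zero[symmetric]; intro elem_eqI; simp)+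
  then show ?thesis by blast
next
  assume c: "p = - 1/2" "a = - 3/2" "b = - \<i>/2"
  \<comment> \<open>Now \<open>v\<close> acts diagonally on \<open>1, \<i>\<close> with eigenvalues \<open>- 2, - 1\<close>, and \<open>v'\<close> sends \<open>1\<close> to \<open>- \<i>\<close> and
      \<open>\<i>\<close> to \<open>0\<close>.  The vector \<open>v' + \<iota> z\<close> is an eigenvector of \<open>v\<close> when \<open>3 Re z = Re w\<close> and
      \<open>2 Im z = Im w\<close>.  The sign in \<open>- v\<close> makes the eigenvalues \<open>2, - 1, 1\<close> of the model.\<close>
  have "lie_isomorphic lie (lie_d4 2)"
  proof (rule isomorphic_d4I[OF dim_4])
    show "no_relation (elem 0 0 1) (elem 0 1 (Complex (Re w / 3) (Im w / 2))) (elem 0 0 \<i>) (elem (- 1) 0 0)"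
      by (rule no_relation_elem) (simp add: complex_eq_iff)
  qed (unfold lie_elem c \<tau> elem_scale elem_uminus elem_zero[symmetric]; intro elem_eqI; simp)+
  then show ?thesis by blast
qed

end

section \<open>Lagrangian splittings and their normal form\<close>

locale lagrangian_splitting = lie_algebra lie
  for lie :: "'a::real_vector \<Rightarrow> 'a \<Rightarrow> 'a" +
  fixes J :: "'a \<Rightarrow> 'a" and \<omega> :: "'a \<Rightarrow> 'a \<Rightarrow> real" and h k :: "'a set"
  assumes dim_4: "dim (UNIV :: 'a set) = 4"
    and linear_J: "linear J"
    and J_J: "J (J x) = - x"
    and integrable: "lie (J x) (J y) - lie x y - J (lie (J x) y) - J (lie x (J y)) = 0"
    and bilinear_omega: "bilinear \<omega>"
    and omega_self: "\<omega> x x = 0"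
    and nondegenerate: "(\<And>y. \<omega> x y = 0) \<Longrightarrow> x = 0"
    and closed: "\<omega> (lie x y) z + \<omega> (lie y z) x + \<omega> (lie z x) y = 0"
    and omega_J: "\<omega> (J x) (J y) = \<omega> x y"
    and subspace_h: "subspace h" and subspace_k: "subspace k"
    and J_h: "x \<in> h \<Longrightarrow> J x \<in> h" and J_k: "x \<in> k \<Longrightarrow> J x \<in> k"
    and lagrangian_h: "x \<in> h \<Longrightarrow> y \<in> h \<Longrightarrow> \<omega> x y = 0"
    and lagrangian_k: "x \<in> k \<Longrightarrow> y \<in> k \<Longrightarrow> \<omega> x y = 0"
    and disjoint: "x \<in> h \<Longrightarrow> x \<in> k \<Longrightarrow> x = 0"
    and decompose: "\<exists>y\<in>h. \<exists>z\<in>k. x = y + z"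
    and ideal: "y \<in> h \<Longrightarrow> lie x y \<in> h"
    and abelian: "x \<in> h \<Longrightarrow> y \<in> h \<Longrightarrow> lie x y = 0"
begin

lemmas omega_simps =
  bilinear_ladd[OF bilinear_omega] bilinear_radd[OF bilinear_omega]
  bilinear_lmul[OF bilinear_omega] bilinear_rmul[OF bilinear_omega]
  bilinear_lneg[OF bilinear_omega] bilinear_rneg[OF bilinear_omega]
  bilinear_lsub[OF bilinear_omega] bilinear_rsub[OF bilinear_omega]
  bilinear_lzero[OF bilinear_omega] bilinear_rzero[OF bilinear_omega]

lemmas J_simps = linear_add[OF linear_J] linear_scale[OF linear_J] linear_diff[OF linear_J]
  linear_neg[OF linear_J] linear_0[OF linear_J] J_J

lemma omega_skew: "\<omega> x y = - \<omega> y x"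
proof -
  have "\<omega> x (x + y) + \<omega> y (x + y) = 0"
    using omega_self[of "x + y"] unfolding bilinear_ladd[OF bilinear_omega] .
  then show ?thesis by (simp add: omega_simps omega_self)
qed

lemma omega_J_right: "\<omega> x (J y) = - \<omega> (J x) y"
  using omega_J[of x "J y"] by (simp add: J_J omega_simps)

text \<open>
  Pairing with \<open>v\<close> is a nonzero functional on \<open>h\<close>, because it vanishes on \<open>k\<close>.  A suitable
  complex multiple of any \<open>y1\<close> on which it does not vanish is dual to \<open>v\<close>.
\<close>
lemma dual_vector:
  assumes "v \<in> k" "v \<noteq> 0"
  shows "\<exists>u\<in>h. \<omega> u v = 1 \<and> \<omega> (J u) v = 0"
proof -
  obtain y where "\<omega> v y \<noteq> 0" using nondegenerate assms(2) by blast
  moreover obtain y1 y2 where "y1 \<in> h" "y2 \<in> k" "y = y1 + y2" using decompose by blast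
  ultimately have "\<omega> v y1 \<noteq> 0"
    using lagrangian_k[OF assms(1)] by (simp add: omega_simps)
  define m where "m = \<omega> y1 v"
  define n where "n = \<omega> (J y1) v"
  define r where "r = m\<^sup>2 + n\<^sup>2"
  have "m \<noteq> 0" using \<open>\<omega> v y1 \<noteq> 0\<close> omega_skew[of y1 v] by (simp add: m_def)
  then have r: "r \<noteq> 0" by (simp add: r_def sum_power2_eq_zero_iff)
  let ?u = "(m / r) *\<^sub>R y1 + (n / r) *\<^sub>R J y1"
  have "?u \<in> h"
    using \<open>y1 \<in> h\<close> J_h subspace_h by (simp add: subspace_add subspace_scale)
  moreover have "\<omega> ?u v = (m\<^sup>2 + n\<^sup>2) / r"
    by (simp add: omega_simps add_divide_distrib power2_eq_square flip: m_def n_def)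
  then have "\<omega> ?u v = 1" using r by (simp flip: r_def)
  moreover have "\<omega> (J ?u) v = 0"
    by (simp add: omega_simps J_simps flip: m_def n_def)
  ultimately show ?thesis by blast
qed

text \<open>
  The basis \<open>u\<close>, \<open>J u\<close>, \<open>v\<close>, \<open>J v\<close> is a Darboux basis, so the coefficients of a relation can be read off
  by pairing with its members.
\<close>
lemma no_relation_dual_pair:
  assumes "u \<in> h" "v \<in> k" "\<omega> u v = 1" "\<omega> (J u) v = 0"
  shows "no_relation u (J u) v (J v)"
  unfolding no_relation_def
proof (intro allI impI)
  fix c1 c2 c3 c4
  assume rel: "c1 *\<^sub>R u + c2 *\<^sub>R J u + c3 *\<^sub>R v + c4 *\<^sub>R J v = 0"
  let ?x = "c1 *\<^sub>R u + c2 *\<^sub>R J u + c3 *\<^sub>R v + c4 *\<^sub>R J v"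
  have 1: "\<omega> u u = 0" "\<omega> u (J u) = 0" "\<omega> (J u) u = 0" "\<omega> (J u) (J u) = 0"
    "\<omega> v v = 0" "\<omega> v (J v) = 0" "\<omega> (J v) v = 0" "\<omega> (J v) (J v) = 0"
    using assms J_h J_k lagrangian_h lagrangian_k by auto
  have 2: "\<omega> u (J v) = 0" "\<omega> (J u) (J v) = 1"
    using assms by (simp_all add: omega_J omega_J_right[of u])
  have "\<omega> ?x v = c1" "\<omega> ?x (J v) = c2" "\<omega> u ?x = c3" "\<omega> (J u) ?x = c4"
    by (simp_all add: omega_simps 1 2 assms)
  then show "c1 = 0 \<and> c2 = 0 \<and> c3 = 0 \<and> c4 = 0"
    unfolding rel by (simp add: omega_simps)
qed

lemma span_dual_pair:
  assumes "u \<in> h" "v \<in> k" "\<omega> u v = 1" "\<omega> (J u) v = 0"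
  shows "x \<in> h \<Longrightarrow> \<exists>s t. x = s *\<^sub>R u + t *\<^sub>R J u"
    and "x \<in> k \<Longrightarrow> \<exists>s t. x = s *\<^sub>R v + t *\<^sub>R J v"
proof -
  have "bij (comb u (J u) v (J v))"
    by (rule bij_comb[OF dim_4 no_relation_dual_pair[OF assms]])
  then obtain c where x: "x = comb u (J u) v (J v) c" by (metis bij_pointE)
  let ?y = "c $ 1 *\<^sub>R u + c $ 2 *\<^sub>R J u" and ?z = "c $ 3 *\<^sub>R v + c $ 4 *\<^sub>R J v"
  have y: "?y \<in> h" and z: "?z \<in> k"
    using assms J_h J_k subspace_h subspace_k by (simp_all add: subspace_add subspace_scale)
  have xyz: "x = ?y + ?z" unfolding x comb_def by simp
  show "\<exists>s t. x = s *\<^sub>R u + t *\<^sub>R J u" if "x \<in> h"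
  proof -
    have "?z = x - ?y" using xyz by simp
    also have "\<dots> \<in> h" by (rule subspace_diff[OF subspace_h that y])
    finally have "?z = 0" using disjoint z by blast
    then show ?thesis using xyz by (metis add.right_neutral)
  qed
  show "\<exists>s t. x = s *\<^sub>R v + t *\<^sub>R J v" if "x \<in> k"
  proof -
    have "?y = x - ?z" using xyz by simp
    also have "\<dots> \<in> k" by (rule subspace_diff[OF subspace_k that z])
    finally have "?y = 0" using disjoint y by blast
    then show ?thesis using xyz by (metis add.left_neutral)
  qed
qed

text \<open>
  Let \<open>[v\<^sub>0, J v\<^sub>0] = \<alpha> v\<^sub>0 + \<beta> J v\<^sub>0\<close> modulo \<open>h\<close>.  Passing from \<open>v\<^sub>0\<close> to a complex multiple \<open>v\<close> multiplies
  the bracket \<open>[v, J v]\<close> by the squared modulus of the factor.  If \<open>\<alpha>\<close> and \<open>\<beta>\<close> are not both \<open>0\<close>,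
  choosing \<open>J v\<close> to be
  \<open>\<rho> (\<alpha> v\<^sub>0 + \<beta> J v\<^sub>0)\<close> with \<open>\<rho> = 1 / (\<alpha>^2 + \<beta>^2)\<close> makes the squared modulus \<open>\<rho>\<close>, and the
  bracket becomes \<open>J v\<close> modulo \<open>h\<close>.
\<close>
lemma normalized_generator:
  assumes "v\<^sub>0 \<in> k" "v\<^sub>0 \<noteq> 0"
  shows "\<exists>v\<in>k. v \<noteq> 0 \<and> (\<exists>\<tau>\<in>{0, 1}. lie v (J v) - \<tau> *\<^sub>R J v \<in> h)"
proof -
  obtain u where u: "u \<in> h" "\<omega> u v\<^sub>0 = 1" "\<omega> (J u) v\<^sub>0 = 0" using dual_vector[OF assms] by blast
  obtain y z where yz: "y \<in> h" "z \<in> k" "lie v\<^sub>0 (J v\<^sub>0) = y + z" using decompose by blast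
  obtain \<alpha> \<beta> where z: "z = \<alpha> *\<^sub>R v\<^sub>0 + \<beta> *\<^sub>R J v\<^sub>0"
    using span_dual_pair(2)[OF u(1) assms(1) u(2,3) yz(2)] by blast
  show ?thesis
  proof (cases "\<alpha> = 0 \<and> \<beta> = 0")
    case True
    then have "lie v\<^sub>0 (J v\<^sub>0) - 0 *\<^sub>R J v\<^sub>0 \<in> h" using yz z by simp
    then show ?thesis using assms by blast
  next
    case False
    define \<rho> where "\<rho> = 1 / (\<alpha>\<^sup>2 + \<beta>\<^sup>2)"
    have \<rho>: "(\<rho> * \<beta>) * (\<rho> * \<beta>) + (\<rho> * \<alpha>) * (\<rho> * \<alpha>) = \<rho>" "\<rho> \<noteq> 0"
    proof -
      have r0: "\<alpha>\<^sup>2 + \<beta>\<^sup>2 \<noteq> 0" using False by (simp add: sum_power2_eq_zero_iff)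
      then show "\<rho> \<noteq> 0" by (simp add: \<rho>_def)
      have "(\<rho> * \<beta>) * (\<rho> * \<beta>) + (\<rho> * \<alpha>) * (\<rho> * \<alpha>) = \<rho> * (\<rho> * (\<alpha>\<^sup>2 + \<beta>\<^sup>2))"
        by (simp add: power2_eq_square algebra_simps)
      also have "\<dots> = \<rho>" using r0 by (simp add: \<rho>_def)
      finally show "(\<rho> * \<beta>) * (\<rho> * \<beta>) + (\<rho> * \<alpha>) * (\<rho> * \<alpha>) = \<rho>" .
    qed
    let ?v = "(\<rho> * \<beta>) *\<^sub>R v\<^sub>0 - (\<rho> * \<alpha>) *\<^sub>R J v\<^sub>0"
    have Jv: "J ?v = (\<rho> * \<beta>) *\<^sub>R J v\<^sub>0 + (\<rho> * \<alpha>) *\<^sub>R v\<^sub>0" by (simp add: J_simps)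
    have "lie ?v (J ?v) = ((\<rho> * \<beta>) * (\<rho> * \<beta>) + (\<rho> * \<alpha>) * (\<rho> * \<alpha>)) *\<^sub>R lie v\<^sub>0 (J v\<^sub>0)"
      unfolding Jv by (simp add: lie_simps lie_skew[of "J v\<^sub>0" v\<^sub>0] algebra_simps)
    then have "lie ?v (J ?v) - 1 *\<^sub>R J ?v = \<rho> *\<^sub>R y"
      unfolding \<rho> Jv yz(3) z by (simp add: algebra_simps)
    then have "lie ?v (J ?v) - 1 *\<^sub>R J ?v \<in> h" using yz(1) subspace_h by (simp add: subspace_scale)
    moreover have "?v \<in> k"
      using assms J_k subspace_k by (simp add: subspace_diff subspace_scale)
    moreover have "?v \<noteq> 0"
    proof
      assume "?v = 0"
      then have "0 *\<^sub>R u + 0 *\<^sub>R J u + (\<rho> * \<beta>) *\<^sub>R v\<^sub>0 + (- \<rho> * \<alpha>) *\<^sub>R J v\<^sub>0 = 0" by simp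
      then have "\<rho> * \<beta> = 0 \<and> - \<rho> * \<alpha> = 0"
        using no_relation_dual_pair[OF u(1) assms(1) u(2,3)] unfolding no_relation_def by blast
      then show False using \<rho>(2) False by simp
    qed
    ultimately show ?thesis by blast
  qed
qed

text \<open>
  Integrability for \<open>v\<close> and a vector of \<open>h\<close> ties the conjugate-linear parts of the actions of \<open>v\<close>
  and \<open>J v\<close> together.  As \<open>\<omega> (\<iota> z) v = Re z\<close> and \<open>\<omega> (\<iota> z) (J v) = Im z\<close>, closedness for \<open>v\<close>,
  \<open>J v\<close> and \<open>\<iota> z\<close> says that the real part of a real-linear function of \<open>z\<close> vanishes identically.
\<close>
lemma normal_form:
  assumes "v\<^sub>0 \<in> k" "v\<^sub>0 \<noteq> 0"
  shows "\<exists>v v' \<iota> a b p w. \<exists>\<tau>\<in>{0, 1}. kaehler_normal_form lie v v' \<iota> a b p w \<tau>"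
proof -
  obtain v \<tau> where v: "v \<in> k" "v \<noteq> 0" and \<tau>: "\<tau> \<in> {0, 1}" "lie v (J v) - \<tau> *\<^sub>R J v \<in> h"
    using normalized_generator[OF assms] by blast
  obtain u where u: "u \<in> h" "\<omega> u v = 1" "\<omega> (J u) v = 0" using dual_vector[OF v] by blast
  define \<iota> where "\<iota> z = Re z *\<^sub>R u + Im z *\<^sub>R J u" for z
  have lin: "linear \<iota>"
    by (rule linearI) (simp_all add: \<iota>_def algebra_simps)
  note iota_simps = linear_add[OF lin] linear_scale[OF lin] linear_diff[OF lin] linear_neg[OF lin]
  have free: "s = 0 \<and> t = 0 \<and> z = 0" if "s *\<^sub>R v + t *\<^sub>R J v + \<iota> z = 0" for s t z
  proof -
    have "Re z *\<^sub>R u + Im z *\<^sub>R J u + s *\<^sub>R v + t *\<^sub>R J v = 0"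
      using that by (simp add: \<iota>_def algebra_simps)
    then have "Re z = 0 \<and> Im z = 0 \<and> s = 0 \<and> t = 0"
      using no_relation_dual_pair[OF u(1) v(1) u(2,3)] unfolding no_relation_def by blast
    then show ?thesis by (simp add: complex_eq_iff)
  qed
  have inj: "z = z'" if "\<iota> z = \<iota> z'" for z z'
    using free[of 0 0 "z - z'"] that by (simp add: iota_simps)
  have iota_h: "\<iota> z \<in> h" for z
    using u(1) J_h subspace_h by (simp add: \<iota>_def subspace_add subspace_scale)
  have h_iota: "\<exists>z. x = \<iota> z" if x: "x \<in> h" for x
  proof -
    obtain s t where "x = s *\<^sub>R u + t *\<^sub>R J u" using span_dual_pair(1)[OF u(1) v(1) u(2,3) x] by blast
    then have "x = \<iota> (Complex s t)" by (simp add: \<iota>_def)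
    then show ?thesis ..
  qed
  have J_iota: "J (\<iota> z) = \<iota> (\<i> * z)" for z
    by (simp add: \<iota>_def J_simps)
  have action: "\<exists>a p. \<forall>z. lie x (\<iota> z) = \<iota> (a * z + p * cnj z)" for x
  proof -
    have "\<forall>z. \<exists>z'. lie x (\<iota> z) = \<iota> z'" using h_iota ideal iota_h by blast
    then obtain f where f: "\<And>z. lie x (\<iota> z) = \<iota> (f z)" by metis
    have "linear f"
      by (rule linearI; rule inj) (simp_all add: iota_simps lie_simps flip: f)
    then show ?thesis using real_linear_complex f by metis
  qed
  obtain a p where A: "\<And>z. lie v (\<iota> z) = \<iota> (a * z + p * cnj z)" using action by metis
  obtain b q where B: "\<And>z. lie (J v) (\<iota> z) = \<iota> (b * z + q * cnj z)" using action by metis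
  obtain w where w: "lie v (J v) = \<tau> *\<^sub>R J v + \<iota> w"
    using h_iota[OF \<tau>(2)] by (metis diff_eq_eq add.commute)
  have q: "q = \<i> * p"
  proof -
    have "\<iota> (b * (\<i> * 1) + q * cnj (\<i> * 1) - (a * 1 + p * cnj 1) - \<i> * (b * 1 + q * cnj 1)
        - \<i> * (a * (\<i> * 1) + p * cnj (\<i> * 1))) = \<iota> 0"
      using integrable[of v "\<iota> 1"] unfolding J_iota A B
      by (simp only: linear_diff[OF lin] linear_0[OF lin])
    then have "b * (\<i> * 1) + q * cnj (\<i> * 1) - (a * 1 + p * cnj 1) - \<i> * (b * 1 + q * cnj 1)
        - \<i> * (a * (\<i> * 1) + p * cnj (\<i> * 1)) = 0" by (rule inj)
    then show ?thesis by (simp add: complex_eq_iff)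
  qed
  have omega_v: "\<omega> (\<iota> z) v = Re z" for z
    by (simp add: \<iota>_def omega_simps u)
  have omega_Jv: "\<omega> (\<iota> z) (J v) = Im z" for z
    by (simp add: omega_J_right J_iota omega_v)
  have "b + \<i> * \<tau> + \<i> * a = - cnj (2 * \<i> * p)"
  proof (rule conjugate_polynomial_zero_Re)
    fix z
    have "lie (\<iota> z) v = - \<iota> (a * z + p * cnj z)" by (subst lie_skew) (simp only: A)
    moreover have "\<omega> (lie v (J v)) (\<iota> z) = - \<tau> * Im z"
      using omega_skew[of "J v" "\<iota> z"] lagrangian_h[OF iota_h iota_h]
      by (simp add: w omega_simps omega_Jv)
    ultimately have "- \<tau> * Im z + Re (b * z + q * cnj z) - Im (a * z + p * cnj z) = 0"
      using closed[of v "J v" "\<iota> z"] by (simp add: B omega_simps omega_v omega_Jv)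
    then show "Re ((b + \<i> * \<tau> + \<i> * a) * z + 2 * \<i> * p * cnj z) = 0"
      by (simp add: q algebra_simps)
  qed
  then have b: "b = - \<i> * a - \<i> * of_real \<tau> + 2 * \<i> * cnj p"
    by (simp add: algebra_simps eq_diff_eq)
  have "kaehler_normal_form lie v (J v) \<iota> a b p w \<tau>"
    by (intro kaehler_normal_form.intro kaehler_normal_form_axioms.intro)
      (fact lie_algebra_axioms dim_4 lin free abelian[OF iota_h iota_h] A B[unfolded q] w b)+
  then show ?thesis using \<tau>(1) by blast
qed

end

section \<open>The classification\<close>

theorem proposition3p2:
  fixes lie lie_k :: "'a::real_vector \<Rightarrow> 'a \<Rightarrow> 'a"
    and J \<pi> :: "'a \<Rightarrow> 'a"
    and \<omega> :: "'a \<Rightarrow> 'a \<Rightarrow> real"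
    and h k :: "'a set"
  assumes "dim (UNIV :: 'a set) = 4"
    and "kaehler_lie_algebra lie J \<omega>"
    and "\<not> lie_abelian_on lie UNIV"
    and "lie_ideal lie h" and "lie_abelian_on lie h"
    and "lie_short_exact lie h k lie_k \<pi>"
    and "J ` h \<subseteq> h" and "J ` k \<subseteq> k"
    and "totally_isotropic (kaehler_metric J \<omega>) h"
    and "totally_isotropic (kaehler_metric J \<omega>) k"
  shows "lie_isomorphic lie lie_R_h3 \<or>
    lie_isomorphic lie lie_aff_C \<or>
    lie_isomorphic lie lie_r4_m1_m1 \<or>
    lie_isomorphic lie (lie_d4 1) \<or>
    lie_isomorphic lie (lie_d4 2)"
proof -
  interpret lie_algebra lie using assms(2) by (simp add: kaehler_lie_algebra_def)
  have cs: "linear J" "\<And>x. J (J x) = - x"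
    "\<And>x y. lie (J x) (J y) - lie x y - J (lie (J x) y) - J (lie x (J y)) = 0"
    using assms(2) by (auto simp: kaehler_lie_algebra_def complex_structure_def)
  have sy: "bilinear \<omega>" "\<And>x. \<omega> x x = 0" "\<And>x. (\<And>y. \<omega> x y = 0) \<Longrightarrow> x = 0"
    "\<And>x y z. \<omega> (lie x y) z + \<omega> (lie y z) x + \<omega> (lie z x) y = 0"
    "\<And>x y. \<omega> (J x) (J y) = \<omega> x y"
    using assms(2) by (auto simp: kaehler_lie_algebra_def symplectic_structure_def)
  have exact: "linear \<pi>" "range \<pi> = k" "{x. \<pi> x = 0} = h" "\<And>x. x \<in> k \<Longrightarrow> \<pi> x = x"
    using assms(6) by (auto simp: lie_short_exact_def)
  have lagrangian: "\<omega> x y = 0"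
    if W: "totally_isotropic (kaehler_metric J \<omega>) W" "J ` W \<subseteq> W" and "x \<in> W" "y \<in> W" for W x y
  proof -
    have "J x \<in> W" using that by blast
    then have "\<omega> (J (J x)) y = 0"
      using W(1) \<open>y \<in> W\<close> by (auto simp: totally_isotropic_def orthogonal_space_def kaehler_metric_def)
    then show ?thesis by (simp add: cs(2) bilinear_lneg[OF sy(1)])
  qed
  have decompose: "\<exists>y\<in>h. \<exists>z\<in>k. x = y + z" for x
  proof (intro bexI)
    show "x = (x - \<pi> x) + \<pi> x" by simp
    show "\<pi> x \<in> k" using exact(2) by blast
    then have "\<pi> (x - \<pi> x) = 0" by (simp add: linear_diff[OF exact(1)] exact(4))
    then show "x - \<pi> x \<in> h" using exact(3) by blast
  qed
  have disjoint: "x = 0" if "x \<in> h" "x \<in> k" for x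
    using exact(3) exact(4) that by force
  interpret lagrangian_splitting lie J \<omega> h k
  proof (intro lagrangian_splitting.intro lagrangian_splitting_axioms.intro)
    show "subspace h" "subspace k"
      using assms(9,10) by (simp_all add: totally_isotropic_def)
    show "lie x y \<in> h" if "y \<in> h" for x y
      using assms(4) that by (simp add: lie_ideal_def)
    show "lie x y = 0" if "x \<in> h" "y \<in> h" for x y
      using assms(5) that by (simp add: lie_abelian_on_def)
    show "J x \<in> h" if "x \<in> h" for x using assms(7) that by blast
    show "J x \<in> k" if "x \<in> k" for x using assms(8) that by blast
  qed (fact lie_algebra_axioms assms(1) cs sy lagrangian[OF assms(9,7)] lagrangian[OF assms(10,8)] disjoint decompose)+
  have "\<exists>v\<in>k. v \<noteq> 0"
  proof (rule ccontr)
    assume "\<not> (\<exists>v\<in>k. v \<noteq> 0)"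
    then have "UNIV = h" using decompose by force
    then show False using assms(3,5) by simp
  qed
  then obtain v\<^sub>0 where "v\<^sub>0 \<in> k" "v\<^sub>0 \<noteq> 0" by blast
  then obtain v v' \<iota> a b p w \<tau> where \<tau>: "\<tau> \<in> {0, 1}"
    and "kaehler_normal_form lie v v' \<iota> a b p w \<tau>"
    using normal_form by metis
  then interpret kaehler_normal_form lie v v' \<iota> a b p w \<tau> by blast
  from \<tau> show ?thesis
    using classification_abelian_quotient[OF _ assms(3)] classification_nonabelian_quotient by blast
qed

end
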